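(* Let $C_n$ be a cycle with edges $e_1,\dots,e_n$ in cyclic order, all of unit length $\ell=1$, and let $\varphi(x)=x/\alpha-\beta$ with $\alpha\ge1$, $\beta\ge0$. Define $\lambda'=\min_{d\in\{1,\dots,n-1\}}\frac{\lfloor d-\min\{d,n-d\}/\alpha+\beta\rfloor}{d}$ and $\lambda=\min\{1,\lambda'\}$. Consider the algorithm Greedy$(C_n,\alpha,\beta)$ which outputs the set $C$ of all edges $e_i$, $i\in\{1,\dots,n\}$, with $\lfloor\lambda i\rfloor-\lfloor\lambda(i-1)\rfloor=1$. Then $C$ is an optimal solution of the problem Contraction on the instance $(C_n,\ell,\varphi)$, and it is computed in time $O(n)$.
   Context: For a graph $G=(V,E)$ with edge lengths $\ell\colon E\to\mathbb{R}_{>0}$ and $C\subseteq E$: $\ell_C$ is the length function equal to $0$ on $C$ and $\ell$ elsewhere; $\mathrm{dist}_\ell$ is shortest-path distance. $C$ is a $\varphi$-contraction if $\mathrm{dist}_{\ell_C}(u,v)\ge\varphi(\mathrm{dist}_\ell(u,v))$ for all $u,v\in V$. $G/C$ denotes the simple graph obtained by contracting $C$, deleting loops and keeping one (shortest) edge among parallel edges; $\Delta(C)$ is the number of deleted loops and parallel edges and $\Phi(C)=|C|+\Delta(C)=m(G)-m(G/C)$. The problem Contraction, on input $(G,\ell,\varphi)$ with $\varphi$ non-decreasing, asks for a $\varphi$-contraction $C$ maximizing $\Phi(C)$ (an optimal solution). *)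

theory Defs
  imports Complex_Main
begin

section \<open>Weighted graphs and contractions\<close>

record 'v sgraph =
  verts :: "'v set"
  edges :: "'v set set"

definition simple_graph :: "'v sgraph \<Rightarrow> bool" where
  "simple_graph G \<longleftrightarrow> finite (verts G) \<and>
     (\<forall>e \<in> edges G. \<exists>u \<in> verts G. \<exists>v \<in> verts G. u \<noteq> v \<and> e = {u, v})"

text \<open>A path is given by its sequence of pairwise distinct vertices; \<open>[v]\<close> is the trivial path.\<close>

definition paths :: "'v sgraph \<Rightarrow> 'v \<Rightarrow> 'v \<Rightarrow> 'v list set" where
  "paths G u v = {p. p \<noteq> [] \<and> set p \<subseteq> verts G \<and> distinct p \<and>
     successively (\<lambda>x y. {x, y} \<in> edges G) p \<and> hd p = u \<and> last p = v}"

definition path_length :: "('v set \<Rightarrow> real) \<Rightarrow> 'v list \<Rightarrow> real" where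
  "path_length l p = (\<Sum>(x, y) \<leftarrow> zip p (tl p). l {x, y})"

text \<open>A finite graph has finitely many paths, so the infimum is a minimum whenever \<open>u\<close> and \<open>v\<close>
  are joined by a path. Otherwise the value is meaningless.\<close>

definition sp_dist :: "'v sgraph \<Rightarrow> ('v set \<Rightarrow> real) \<Rightarrow> 'v \<Rightarrow> 'v \<Rightarrow> real" where
  "sp_dist G l u v = Inf (path_length l ` paths G u v)"

definition zero_on :: "'v set set \<Rightarrow> ('v set \<Rightarrow> real) \<Rightarrow> 'v set \<Rightarrow> real" where
  "zero_on C l = (\<lambda>e. if e \<in> C then 0 else l e)"

text \<open>Pairs in different components are left out: both of their distances are infinite.\<close>

definition is_contraction ::
    "'v sgraph \<Rightarrow> ('v set \<Rightarrow> real) \<Rightarrow> (real \<Rightarrow> real) \<Rightarrow> 'v set set \<Rightarrow> bool" where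
  "is_contraction G l \<phi> C \<longleftrightarrow> C \<subseteq> edges G \<and>
     (\<forall>u \<in> verts G. \<forall>v \<in> verts G. paths G u v \<noteq> {} \<longrightarrow>
        sp_dist G (zero_on C l) u v \<ge> \<phi> (sp_dist G l u v))"

text \<open>The vertices of the contracted graph are the components of the spanning subgraph with edge
  set \<open>C\<close>; an edge \<open>{u, v}\<close> outside \<open>C\<close> is sent to the set of the components of \<open>u\<close> and \<open>v\<close>, which
  is a singleton iff the edge becomes a loop. Parallel edges have the same image.\<close>

definition comp_of :: "'v sgraph \<Rightarrow> 'v set set \<Rightarrow> 'v \<Rightarrow> 'v set" where
  "comp_of G C v = {w. paths (G\<lparr>edges := C\<rparr>) v w \<noteq> {}}"

definition contract :: "'v sgraph \<Rightarrow> 'v set set \<Rightarrow> 'v set sgraph" where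
  "contract G C = \<lparr>verts = comp_of G C ` verts G,
     edges = {comp_of G C ` e |e. e \<in> edges G - C \<and> card (comp_of G C ` e) \<noteq> 1}\<rparr>"

definition deleted_loops :: "'v sgraph \<Rightarrow> 'v set set \<Rightarrow> nat" where
  "deleted_loops G C = card {e \<in> edges G - C. card (comp_of G C ` e) = 1}"

definition deleted_parallels :: "'v sgraph \<Rightarrow> 'v set set \<Rightarrow> nat" where
  "deleted_parallels G C =
     (\<Sum>f \<in> edges (contract G C). card {e \<in> edges G - C. comp_of G C ` e = f} - 1)"

definition Delta :: "'v sgraph \<Rightarrow> 'v set set \<Rightarrow> nat" where
  "Delta G C = deleted_loops G C + deleted_parallels G C"

definition Phi :: "'v sgraph \<Rightarrow> 'v set set \<Rightarrow> nat" where
  "Phi G C = card C + Delta G C"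

lemma Phi_eq:
  assumes "simple_graph G" and C: "C \<subseteq> edges G"
  shows "Phi G C = card (edges G) - card (edges (contract G C))"
    and "card (edges (contract G C)) \<le> card (edges G)"
proof -
  define c where "c = (\<lambda>e. comp_of G C ` e)"
  define S where "S = edges G - C"
  define L where "L = {e \<in> S. card (c e) = 1}"
  define N where "N = {e \<in> S. card (c e) \<noteq> 1}"
  define H where "H = edges (contract G C)"
  have V: "finite (verts G)" and "edges G \<subseteq> Pow (verts G)"
    using assms(1) unfolding simple_graph_def by (simp, fastforce)
  then have fin: "finite (edges G)"
    by (meson finite_Pow_iff finite_subset)
  then have finS: "finite S" and finN: "finite N"
    unfolding N_def S_def by simp_all
  have H: "H = c ` N"
    unfolding H_def N_def S_def c_def contract_def
    by (simp only: sgraph.simps setcompr_eq_image)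
  have fibre: "{e \<in> N. c e = f} = {e \<in> S. c e = f}" "{e \<in> S. c e = f} \<noteq> {}" if "f \<in> H" for f
    using that unfolding H N_def by auto
  have "card N = (\<Sum>f\<in>H. card {e \<in> N. c e = f})"
    using sum.image_gen[OF finN, of "\<lambda>_. 1::nat" c] unfolding H by simp
  also have "\<dots> = (\<Sum>f\<in>H. (card {e \<in> S. c e = f} - 1) + 1)"
  proof (rule sum.cong[OF refl])
    fix f assume f: "f \<in> H"
    have "card {e \<in> S. c e = f} > 0"
      using fibre(2)[OF f] finS by (simp only: card_gt_0_iff) simp
    then show "card {e \<in> N. c e = f} = (card {e \<in> S. c e = f} - 1) + 1"
      unfolding fibre(1)[OF f] by simp
  qed
  also have "\<dots> = deleted_parallels G C + card H"
    unfolding deleted_parallels_def sum.distrib H_def S_def c_def by simp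
  finally have N: "card N = deleted_parallels G C + card H" .
  have L: "card L = deleted_loops G C"
    unfolding deleted_loops_def L_def S_def c_def ..
  have "card (edges G) = card C + card S"
    unfolding S_def using C fin by (simp add: card_Diff_subset card_mono finite_subset)
  moreover have "S = L \<union> N" "L \<inter> N = {}" "finite L"
    using finS unfolding L_def N_def by auto
  then have "card S = card L + card N"
    using finN by (simp add: card_Un_disjoint)
  ultimately have "card (edges G) = Phi G C + card H"
    unfolding Phi_def Delta_def N L by simp
  then show "Phi G C = card (edges G) - card (edges (contract G C))"
    and "card (edges (contract G C)) \<le> card (edges G)"
    unfolding H_def by simp_all
qed

definition contraction_instance ::
    "'v sgraph \<Rightarrow> ('v set \<Rightarrow> real) \<Rightarrow> (real \<Rightarrow> real) \<Rightarrow> bool" where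
  "contraction_instance G l \<phi> \<longleftrightarrow>
     simple_graph G \<and> (\<forall>e \<in> edges G. l e > 0) \<and> mono_on {0..} \<phi>"

definition optimal_solution ::
    "'v sgraph \<Rightarrow> ('v set \<Rightarrow> real) \<Rightarrow> (real \<Rightarrow> real) \<Rightarrow> 'v set set \<Rightarrow> bool" where
  "optimal_solution G l \<phi> C \<longleftrightarrow>
     contraction_instance G l \<phi> \<and> is_contraction G l \<phi> C \<and>
     (\<forall>C'. is_contraction G l \<phi> C' \<longrightarrow> Phi G C' \<le> Phi G C)"


section \<open>Cycles and the greedy solution\<close>

text \<open>\<open>cycle_edge n i\<close> is the edge \<open>e\<^sub>i\<close>, for \<open>i \<in> {1..n}\<close>.\<close>

definition cycle_edge :: "nat \<Rightarrow> nat \<Rightarrow> nat set" where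
  "cycle_edge n i = {i - 1, i mod n}"

definition cycle :: "nat \<Rightarrow> nat sgraph" where
  "cycle n = \<lparr>verts = {0..<n}, edges = cycle_edge n ` {1..n}\<rparr>"

definition lambda' :: "nat \<Rightarrow> real \<Rightarrow> real \<Rightarrow> real" where
  "lambda' n \<alpha> \<beta> =
     (MIN d \<in> {1..n - 1}. of_int \<lfloor>real d - real (min d (n - d)) / \<alpha> + \<beta>\<rfloor> / real d)"

definition lambda :: "nat \<Rightarrow> real \<Rightarrow> real \<Rightarrow> real" where
  "lambda n \<alpha> \<beta> = min 1 (lambda' n \<alpha> \<beta>)"

definition greedy :: "nat \<Rightarrow> real \<Rightarrow> real \<Rightarrow> nat set set" where
  "greedy n \<alpha> \<beta> = {cycle_edge n i |i. i \<in> {1..n} \<and>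
     \<lfloor>lambda n \<alpha> \<beta> * real i\<rfloor> - \<lfloor>lambda n \<alpha> \<beta> * (real i - 1)\<rfloor> = 1}"


section \<open>The algorithm and its running time\<close>

text \<open>Running time is measured in the unit-cost model: imperative programs over real-valued
  variables, where every elementary step (reading a variable or a constant, an arithmetic
  operation, rounding down, a comparison, a jump, an assignment, writing one output item) costs 1.
  Constants are integers, so that no information can be hidden in a program.\<close>

type_synonym vname = string

datatype aexp = Const int | Var vname
  | Add aexp aexp | Sub aexp aexp | Mul aexp aexp | Div aexp aexp | Floor aexp

datatype bexp = Less aexp aexp | Leq aexp aexp | Equal aexp aexp

datatype com = Skip | Assign vname aexp | Output aexp
  | Seq com com | If bexp com com | While bexp com

type_synonym state = "(vname \<Rightarrow> real) \<times> real list"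

fun aval :: "aexp \<Rightarrow> (vname \<Rightarrow> real) \<Rightarrow> real" where
  "aval (Const k) s = of_int k"
| "aval (Var x) s = s x"
| "aval (Add a b) s = aval a s + aval b s"
| "aval (Sub a b) s = aval a s - aval b s"
| "aval (Mul a b) s = aval a s * aval b s"
| "aval (Div a b) s = aval a s / aval b s"
| "aval (Floor a) s = of_int \<lfloor>aval a s\<rfloor>"

fun acost :: "aexp \<Rightarrow> nat" where
  "acost (Const k) = 1"
| "acost (Var x) = 1"
| "acost (Add a b) = acost a + acost b + 1"
| "acost (Sub a b) = acost a + acost b + 1"
| "acost (Mul a b) = acost a + acost b + 1"
| "acost (Div a b) = acost a + acost b + 1"
| "acost (Floor a) = acost a + 1"

fun bval :: "bexp \<Rightarrow> (vname \<Rightarrow> real) \<Rightarrow> bool" where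
  "bval (Less a b) s \<longleftrightarrow> aval a s < aval b s"
| "bval (Leq a b) s \<longleftrightarrow> aval a s \<le> aval b s"
| "bval (Equal a b) s \<longleftrightarrow> aval a s = aval b s"

fun bcost :: "bexp \<Rightarrow> nat" where
  "bcost (Less a b) = acost a + acost b + 1"
| "bcost (Leq a b) = acost a + acost b + 1"
| "bcost (Equal a b) = acost a + acost b + 1"

text \<open>\<open>exec c st t st'\<close>: program \<open>c\<close> started in state \<open>st\<close> halts in state \<open>st'\<close> after \<open>t\<close> steps.\<close>

inductive exec :: "com \<Rightarrow> state \<Rightarrow> nat \<Rightarrow> state \<Rightarrow> bool" where
  Skip: "exec Skip st 1 st"
| Assign: "exec (Assign x a) (s, out) (acost a + 1) (s(x := aval a s), out)"
| Output: "exec (Output a) (s, out) (acost a + 1) (s, out @ [aval a s])"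
| Seq: "exec c1 st t1 st1 \<Longrightarrow> exec c2 st1 t2 st2 \<Longrightarrow> exec (Seq c1 c2) st (t1 + t2) st2"
| IfTrue: "bval b (fst st) \<Longrightarrow> exec c1 st t st1 \<Longrightarrow> exec (If b c1 c2) st (bcost b + t + 1) st1"
| IfFalse: "\<not> bval b (fst st) \<Longrightarrow> exec c2 st t st1 \<Longrightarrow> exec (If b c1 c2) st (bcost b + t + 1) st1"
| WhileFalse: "\<not> bval b (fst st) \<Longrightarrow> exec (While b c) st (bcost b + 1) st"
| WhileTrue: "bval b (fst st) \<Longrightarrow> exec c st t1 st1 \<Longrightarrow> exec (While b c) st1 t2 st2 \<Longrightarrow>
    exec (While b c) st (bcost b + t1 + t2 + 1) st2"

inductive_cases exec_elims:
  "exec Skip st t st'" "exec (Assign x a) st t st'" "exec (Output a) st t st'"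
  "exec (Seq c1 c2) st t st'" "exec (If b c1 c2) st t st'"

inductive_cases exec_WhileE: "exec (While b c) st t st'"

lemma exec_deterministic:
  "exec c st t st1 \<Longrightarrow> exec c st t' st1' \<Longrightarrow> t' = t \<and> st1' = st1"
proof (induction arbitrary: t' st1' rule: exec.induct)
  case (Skip st)
  then show ?case by (auto elim: exec_elims)
next
  case (Assign x a s out)
  then show ?case by (auto elim: exec_elims)
next
  case (Output a s out)
  then show ?case by (auto elim: exec_elims)
next
  case (Seq c1 st t1 st1 c2 t2 st2)
  from Seq.prems show ?case by (rule exec_elims(4)) (metis Seq.IH)
next
  case (IfTrue b st c1 t st1 c2)
  from IfTrue.prems show ?case
    by (rule exec_elims(5)) (use IfTrue.hyps in \<open>auto dest: IfTrue.IH\<close>)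
next
  case (IfFalse b st c2 t st1 c1)
  from IfFalse.prems show ?case
    by (rule exec_elims(5)) (use IfFalse.hyps in \<open>auto dest: IfFalse.IH\<close>)
next
  case (WhileFalse b st c)
  from WhileFalse.prems show ?case by (rule exec_WhileE) (use WhileFalse.hyps in auto)
next
  case (WhileTrue b st c t1 st1 t2 st2)
  from WhileTrue.prems show ?case
  proof (rule exec_WhileE)
    assume "\<not> bval b (fst st)"
    then show ?thesis using WhileTrue.hyps by simp
  next
    fix u1 st' u2
    assume t': "t' = Suc (bcost b + u1 + u2)"
      and c: "exec c st u1 st'" and w: "exec (While b c) st' u2 st1'"
    from WhileTrue.IH(1)[OF c] have 1: "u1 = t1" "st' = st1" by auto
    with w have "u2 = t2 \<and> st1' = st2" using WhileTrue.IH(2) by blast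
    with t' 1 show ?thesis by simp
  qed
qed

definition compute_lambda :: com where
  "compute_lambda =
     Seq (Assign ''lam'' (Const 1))
    (Seq (Assign ''d'' (Const 1))
         (While (Less (Var ''d'') (Var ''n''))
           (Seq (If (Less (Var ''d'') (Sub (Var ''n'') (Var ''d'')))
                   (Assign ''m'' (Var ''d''))
                   (Assign ''m'' (Sub (Var ''n'') (Var ''d''))))
           (Seq (Assign ''q''
                   (Div (Floor (Add (Sub (Var ''d'') (Div (Var ''m'') (Var ''alpha''))) (Var ''beta'')))
                        (Var ''d'')))
           (Seq (If (Less (Var ''q'') (Var ''lam'')) (Assign ''lam'' (Var ''q'')) Skip)
                (Assign ''d'' (Add (Var ''d'') (Const 1))))))))"

definition output_edges :: com where
  "output_edges =
     Seq (Assign ''i'' (Const 1))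
         (While (Leq (Var ''i'') (Var ''n''))
           (Seq (If (Equal (Sub (Floor (Mul (Var ''lam'') (Var ''i'')))
                                (Floor (Mul (Var ''lam'') (Sub (Var ''i'') (Const 1)))))
                           (Const 1))
                   (Output (Var ''i''))
                   Skip)
                (Assign ''i'' (Add (Var ''i'') (Const 1)))))"

definition greedy_program :: com where
  "greedy_program = Seq compute_lambda output_edges"

definition greedy_input :: "nat \<Rightarrow> real \<Rightarrow> real \<Rightarrow> state" where
  "greedy_input n \<alpha> \<beta> =
     ((\<lambda>_. 0)(''n'' := real n, ''alpha'' := \<alpha>, ''beta'' := \<beta>), [])"

text \<open>The edge \<open>e\<^sub>i\<close> is output as its index \<open>i\<close>, and no edge may be output twice.\<close>

definition greedy_outputs_within :: "nat \<Rightarrow> real \<Rightarrow> real \<Rightarrow> nat set set \<Rightarrow> nat \<Rightarrow> bool" where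
  "greedy_outputs_within n \<alpha> \<beta> C T \<longleftrightarrow>
     (\<exists>s js t. exec greedy_program (greedy_input n \<alpha> \<beta>) t (s, map real js) \<and> t \<le> T \<and>
        distinct js \<and> set js \<subseteq> {1..n} \<and> C = cycle_edge n ` set js)"

end

theory Submission
  imports Defs
begin

text \<open>
  Two vertices of the cycle at positions \<open>u < v\<close> are joined by exactly two arcs, so \<open>C\<close> is a
  contraction iff every arc of \<open>d\<close> edges, \<open>1 \<le> d < n\<close>, contains at most
  \<open>b d = \<lfloor>d - min d (n - d) / \<alpha> + \<beta>\<rfloor>\<close> edges of \<open>C\<close>. Averaging over the \<open>n\<close> arcs of \<open>d\<close>
  edges gives \<open>d \<cdot> |C| \<le> n \<cdot> b d\<close>, hence \<open>|C| \<le> \<lfloor>\<lambda> n\<rfloor>\<close>. The jumps of \<open>i \<mapsto> \<lfloor>\<lambda> i\<rfloor>\<close> attain this bound,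
  and an arc of \<open>d\<close> edges contains at most \<open>\<lceil>\<lambda> d\<rceil> \<le> b d\<close> of them; for arcs through vertex \<open>0\<close> this uses
  superadditivity of the floor. Finally \<open>\<Phi>\<close> is monotone in \<open>|C|\<close>: nothing is deleted for
  \<open>|C| \<le> n - 3\<close>, one of two parallel edges for \<open>|C| = n - 2\<close>, and \<open>\<Phi> = n\<close> beyond that.
\<close>

section \<open>Paths and their edges\<close>

definition path_edges :: "'v list \<Rightarrow> 'v set list" where
  "path_edges p = map (\<lambda>(x, y). {x, y}) (zip p (tl p))"

lemma path_edges_simps [simp]:
  "path_edges [] = []" "path_edges [x] = []"
  "path_edges (x # y # p) = {x, y} # path_edges (y # p)"
  by (simp_all add: path_edges_def)

lemma path_edges_append:
  "p \<noteq> [] \<Longrightarrow> q \<noteq> [] \<Longrightarrow> path_edges (p @ q) = path_edges p @ {last p, hd q} # path_edges q"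
proof (induction p rule: induct_list012)
  case (2 x)
  then show ?case by (cases q) simp_all
qed simp_all

lemma path_edges_rev: "path_edges (rev p) = rev (path_edges p)"
proof (induction p rule: induct_list012)
  case (3 x y p)
  have "path_edges (rev (y # p) @ [x]) = path_edges (rev (y # p)) @ [{y, x}]"
    by (subst path_edges_append) (auto simp: last_rev)
  then show ?case using 3 by (simp add: insert_commute)
qed simp_all

lemma path_length_conv: "path_length l p = sum_list (map l (path_edges p))"
  by (simp add: path_length_def path_edges_def case_prod_unfold o_def)

lemma successively_conv_path_edges:
  "successively (\<lambda>x y. {x, y} \<in> E) p \<longleftrightarrow> set (path_edges p) \<subseteq> E"
  by (induction p rule: induct_list012) auto

lemma mem_paths_iff:
  "p \<in> paths G u v \<longleftrightarrow> p \<noteq> [] \<and> set p \<subseteq> verts G \<and> distinct p \<and>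
     set (path_edges p) \<subseteq> edges G \<and> hd p = u \<and> last p = v"
  by (simp add: paths_def successively_conv_path_edges)

lemma sum_le_path_length:
  fixes l :: "'v set \<Rightarrow> real"
  assumes "\<And>e. l e \<ge> 0" and "A \<subseteq> set (path_edges p)"
  shows "sum l A \<le> path_length l p"
proof -
  have "sum l (set es) \<le> sum_list (map l es)" for es
    by (induction es) (use assms(1) in \<open>auto simp: sum.insert_if add_increasing\<close>)
  moreover have "sum l A \<le> sum l (set (path_edges p))"
    using assms by (intro sum_mono2) auto
  ultimately show ?thesis
    unfolding path_length_conv by (meson order_trans)
qed

text \<open>Cut argument: a path none of whose edges crosses the border of \<open>S\<close> stays on
  one side. It serves both the distances in a cycle and the separation of components.\<close>

lemma hd_in_iff_last_in:
  assumes "p \<noteq> []" and "\<And>x y. {x, y} \<in> set (path_edges p) \<Longrightarrow> x \<in> S \<longleftrightarrow> y \<in> S"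
  shows "hd p \<in> S \<longleftrightarrow> last p \<in> S"
  using assms
proof (induction p rule: induct_list012)
  case (3 x y p)
  have "x \<in> S \<longleftrightarrow> y \<in> S" using 3(4)[of x y] by simp
  moreover have "hd (y # p) \<in> S \<longleftrightarrow> last (y # p) \<in> S"
    by (rule 3(2)) (simp, rule 3(4), simp)
  ultimately show ?case by simp
qed simp_all

lemma sp_dist_commute: "sp_dist G l u v = sp_dist G l v u"
proof -
  have "path_length l ` paths G x y \<subseteq> path_length l ` paths G y x" for x y
  proof
    fix r assume "r \<in> path_length l ` paths G x y"
    then obtain p where p: "p \<in> paths G x y" "r = path_length l p" by auto
    then have "rev p \<in> paths G y x" "path_length l (rev p) = r"
      by (auto simp: mem_paths_iff path_edges_rev hd_rev last_rev path_length_conv simp flip: rev_map)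
    then show "r \<in> path_length l ` paths G y x" by blast
  qed
  then show ?thesis unfolding sp_dist_def by (metis subset_antisym)
qed

lemma sp_dist_refl:
  assumes "\<And>e. l e \<ge> 0" and "v \<in> verts G"
  shows "sp_dist G l v v = 0"
  unfolding sp_dist_def
proof (rule cInf_eq_minimum)
  have "[v] \<in> paths G v v" "path_length l [v] = 0"
    using assms(2) by (auto simp: mem_paths_iff path_length_conv)
  then show "0 \<in> path_length l ` paths G v v" by force
  show "0 \<le> x" if "x \<in> path_length l ` paths G v v" for x
    using that sum_le_path_length[of l "{}"] assms(1) by auto
qed

section \<open>Distances in a cycle\<close>

lemma verts_cycle [simp]: "verts (cycle n) = {0..<n}"
  and edges_cycle [simp]: "edges (cycle n) = cycle_edge n ` {1..n}"
  by (simp_all add: cycle_def)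

lemma cycle_edge_less: "i < n \<Longrightarrow> cycle_edge n i = {i - 1, i}"
  and cycle_edge_last: "cycle_edge n n = {n - 1, 0}"
  by (simp_all add: cycle_edge_def)

text \<open>For n = 2 the indices 1 and 2 name the same edge. From n = 3 on, sets of edges can be
  replaced by sets of indices.\<close>

lemma inj_on_cycle_edge:
  assumes "n \<ge> 3" shows "inj_on (cycle_edge n) {1..n}"
proof (rule inj_onI)
  fix i j assume "i \<in> {1..n}" "j \<in> {1..n}" "cycle_edge n i = cycle_edge n j"
  then show "i = j"
    using assms by (cases "i = n"; cases "j = n")
      (auto simp: cycle_edge_less cycle_edge_last doubleton_eq_iff)
qed

text \<open>Edge i joins i - 1 to i, so the block \<open>{a..<b}\<close> is entered only through
  edge a and left only through edge b. Vertex 0 lies outside it because 1 \<le> a.\<close>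

lemma cycle_edge_not_crossing:
  assumes "1 \<le> a" "b \<le> n" "i \<in> {1..n}" "i \<noteq> a" "i \<noteq> b" "{x, y} = cycle_edge n i"
  shows "x \<in> {a..<b} \<longleftrightarrow> y \<in> {a..<b}"
proof (cases "i = n")
  case True
  then show ?thesis using assms by (auto simp: cycle_edge_last doubleton_eq_iff)
next
  case False
  then show ?thesis using assms by (auto simp: cycle_edge_less doubleton_eq_iff)
qed

text \<open>If a path missed an edge i of the arc from u to v and an edge j outside that arc, the
  block between i and j would contain exactly one of u and v, while i and j are the only edges
  crossing its border.\<close>

lemma cycle_path_covers_arc:
  assumes p: "p \<in> paths (cycle n) u v" and uv: "u < v" "v < n"
  obtains "cycle_edge n ` {u<..v} \<subseteq> set (path_edges p)"
  | "cycle_edge n ` ({1..n} - {u<..v}) \<subseteq> set (path_edges p)"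
proof -
  have False if i: "i \<in> {u<..v}" "cycle_edge n i \<notin> set (path_edges p)"
    and j: "j \<in> {1..n} - {u<..v}" "cycle_edge n j \<notin> set (path_edges p)" for i j
  proof -
    have closed: "x \<in> {min i j..<max i j} \<longleftrightarrow> y \<in> {min i j..<max i j}"
      if e: "{x, y} \<in> set (path_edges p)" for x y
    proof -
      from e p obtain k where k: "k \<in> {1..n}" "{x, y} = cycle_edge n k"
        by (force simp: mem_paths_iff)
      moreover have "k \<noteq> i" "k \<noteq> j" using k e i j by auto
      ultimately show ?thesis
        using i j uv by (intro cycle_edge_not_crossing[of _ _ n k]) (auto simp: min_def max_def)
    qed
    have "u \<in> {min i j..<max i j} \<longleftrightarrow> v \<in> {min i j..<max i j}"
      using hd_in_iff_last_in[where p = p, OF _ closed] p by (simp add: mem_paths_iff)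
    then show False using i(1) j(1) uv by (auto simp: min_def max_def split: if_splits)
  qed
  then show ?thesis using that by blast
qed

text \<open>The edge between i - 1 and i has index i, hence the indices start at
  \<open>Suc u\<close>.\<close>

lemma path_edges_upt:
  "u < n \<Longrightarrow> v < n \<Longrightarrow> path_edges [u..<Suc v] = map (cycle_edge n) [Suc u..<Suc v]"
proof (induction v)
  case 0
  then show ?case by (cases u) auto
next
  case (Suc v)
  show ?case
  proof (cases "u \<le> v")
    case True
    then have "path_edges ([u..<Suc v] @ [Suc v]) = map (cycle_edge n) [Suc u..<Suc v] @ [{v, Suc v}]"
      using Suc by (subst path_edges_append) auto
    then show ?thesis using True Suc.prems by (simp add: cycle_edge_less)
  next
    case False
    then show ?thesis by (cases "u = Suc v") auto
  qed
qed

lemma cycle_arcs: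
  assumes uv: "u < v" "v < n" and n: "n \<ge> 3"
  obtains p q where "p \<in> paths (cycle n) u v" "q \<in> paths (cycle n) u v"
    and "\<And>l. path_length l p = (\<Sum>i\<in>{u<..v}. l (cycle_edge n i))"
    and "\<And>l. path_length l q = (\<Sum>i\<in>{1..n} - {u<..v}. l (cycle_edge n i))"
proof
  let ?p = "[u..<Suc v]"
  \<comment> \<open>The other way round: descend from u to 0, cross edge n to n - 1, descend to v.
    The upper end is written \<open>Suc (n - 1)\<close> to fit
    \<open>path_edges_upt\<close>.\<close>
  let ?q = "rev [0..<Suc u] @ rev [v..<Suc (n - 1)]"
  have p: "path_edges ?p = map (cycle_edge n) [Suc u..<Suc v]"
    using uv by (intro path_edges_upt) auto
  have "path_edges ?q = path_edges (rev [0..<Suc u]) @ {0, n - 1} # path_edges (rev [v..<Suc (n - 1)])"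
    using uv by (subst path_edges_append) (auto simp: last_rev hd_rev)
  also have "{0, n - 1} = cycle_edge n n" by (auto simp: cycle_edge_last)
  also have "path_edges (rev [0..<Suc u]) = rev (map (cycle_edge n) [1..<Suc u])"
    using path_edges_upt[of 0 n u] uv by (simp only: path_edges_rev) simp
  also have "path_edges (rev [v..<Suc (n - 1)]) = rev (map (cycle_edge n) [Suc v..<n])"
    using path_edges_upt[of v n "n - 1"] uv by (simp only: path_edges_rev) simp
  finally have q: "path_edges ?q = map (cycle_edge n) (rev [1..<Suc u] @ n # rev [Suc v..<n])"
    by (simp only: rev_map map_append list.map)
  have S: "set (rev [1..<Suc u] @ n # rev [Suc v..<n]) = {1..n} - {u<..v}"
    "distinct (rev [1..<Suc u] @ n # rev [Suc v..<n])"
    using uv by auto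
  show "?p \<in> paths (cycle n) u v"
    unfolding mem_paths_iff p using uv by (auto simp del: upt_Suc simp: hd_upt last_upt)
  show "?q \<in> paths (cycle n) u v"
    unfolding mem_paths_iff q set_map S(1) using uv by (auto simp: last_rev hd_rev)
  show "path_length l ?p = (\<Sum>i\<in>{u<..v}. l (cycle_edge n i))" for l
    unfolding path_length_conv p map_map by (subst sum_list_distinct_conv_sum_set) 
      (auto simp del: upt_Suc simp: atLeastLessThanSuc_atLeastAtMost atLeastSucAtMost_greaterThanAtMost)
  show "path_length l ?q = (\<Sum>i\<in>{1..n} - {u<..v}. l (cycle_edge n i))" for l
    unfolding path_length_conv q map_map S(1)[symmetric] sum_list_distinct_conv_sum_set[OF S(2)] by simp
qed

text \<open>Each arc is itself a path, and every path covers one of the two arcs. Lengths may be 0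
  because the formula is applied to \<open>zero_on\<close> as well.\<close>

lemma sp_dist_cycle:
  assumes n: "n \<ge> 3" and uv: "u < v" "v < n" and l: "\<And>e. l e \<ge> 0"
  shows "sp_dist (cycle n) l u v =
    min (\<Sum>i\<in>{u<..v}. l (cycle_edge n i)) (\<Sum>i\<in>{1..n} - {u<..v}. l (cycle_edge n i))"
    (is "_ = min ?s ?t")
proof -
  obtain p q where pq: "p \<in> paths (cycle n) u v" "q \<in> paths (cycle n) u v"
    "path_length l p = ?s" "path_length l q = ?t"
    using cycle_arcs[OF uv n] by metis
  have inj: "inj_on (cycle_edge n) A" if "A \<subseteq> {1..n}" for A
    using inj_on_cycle_edge[OF n] that by (rule inj_on_subset)
  show ?thesis unfolding sp_dist_def
  proof (rule cInf_eq_minimum)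
    have "?s \<in> path_length l ` paths (cycle n) u v" "?t \<in> path_length l ` paths (cycle n) u v"
      unfolding pq(3,4)[symmetric] using pq(1,2) by auto
    then show "min ?s ?t \<in> path_length l ` paths (cycle n) u v"
      by (simp add: min_def)
    fix x assume "x \<in> path_length l ` paths (cycle n) u v"
    then obtain r where r: "r \<in> paths (cycle n) u v" "x = path_length l r" by auto
    from r(1) uv show "min ?s ?t \<le> x"
    proof (cases rule: cycle_path_covers_arc)
      case 1
      then have "sum l (cycle_edge n ` {u<..v}) \<le> x"
        unfolding r(2) by (intro sum_le_path_length l)
      moreover have "sum l (cycle_edge n ` {u<..v}) = ?s"
        using uv by (subst sum.reindex[OF inj]) auto
      ultimately show ?thesis by simp
    next
      case 2
      then have "sum l (cycle_edge n ` ({1..n} - {u<..v})) \<le> x"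
        unfolding r(2) by (intro sum_le_path_length l)
      moreover have "sum l (cycle_edge n ` ({1..n} - {u<..v})) = ?t"
        by (subst sum.reindex[OF inj]) auto
      ultimately show ?thesis by simp
    qed
  qed
qed

section \<open>Contractions of a cycle as bounds on its arcs\<close>

definition arc_bound :: "nat \<Rightarrow> real \<Rightarrow> real \<Rightarrow> nat \<Rightarrow> int" where
  "arc_bound n \<alpha> \<beta> d = \<lfloor>real d - real (min d (n - d)) / \<alpha> + \<beta>\<rfloor>"

text \<open>The meaning of \<open>arc_bound\<close>: k contracted edges leave length d - k on an arc
  of d edges, and this must be at least \<phi> of \<open>min d (n - d)\<close>, the original
  distance of its ends.\<close>

lemma le_arc_bound_iff:
  "int k \<le> arc_bound n \<alpha> \<beta> d \<longleftrightarrow> real (min d (n - d)) / \<alpha> - \<beta> \<le> real d - real k"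
  unfolding arc_bound_def le_floor_iff by auto

lemma arc_bound_nonneg: "\<alpha> \<ge> 1 \<Longrightarrow> \<beta> \<ge> 0 \<Longrightarrow> arc_bound n \<alpha> \<beta> d \<ge> 0"
proof -
  assume "\<alpha> \<ge> 1" "\<beta> \<ge> 0"
  then have "real (min d (n - d)) \<le> real d * \<alpha>"
    using mult_left_mono[of 1 \<alpha> "real d"] by simp
  then have "real (min d (n - d)) / \<alpha> \<le> real d"
    using \<open>\<alpha> \<ge> 1\<close> by (simp add: divide_le_eq)
  then show ?thesis using le_arc_bound_iff[of 0 n \<alpha> \<beta> d] \<open>\<beta> \<ge> 0\<close> by simp
qed

text \<open>The distance after contraction is a minimum over both arcs, so it is large enough iff
  each arc is long enough by itself. The complementary arc has n - (v - u) edges, which gives the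
  second condition.\<close>

lemma is_contraction_cycle_iff:
  assumes n: "n \<ge> 3" and I: "I \<subseteq> {1..n}" and \<beta>: "\<beta> \<ge> 0"
  shows "is_contraction (cycle n) (\<lambda>_. 1) (\<lambda>x. x / \<alpha> - \<beta>) (cycle_edge n ` I) \<longleftrightarrow>
    (\<forall>u v. u < v \<and> v < n \<longrightarrow> int (card (I \<inter> {u<..v})) \<le> arc_bound n \<alpha> \<beta> (v - u) \<and>
        int (card (I - {u<..v})) \<le> arc_bound n \<alpha> \<beta> (n - (v - u)))"
    (is "_ \<longleftrightarrow> (\<forall>u v. _ \<longrightarrow> ?arcs u v)")
proof -
  define l :: "nat set \<Rightarrow> real" where "l = (\<lambda>_. 1)"
  define l0 where "l0 = zero_on (cycle_edge n ` I) l"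
  define P where "P u v \<longleftrightarrow> sp_dist (cycle n) l u v / \<alpha> - \<beta> \<le> sp_dist (cycle n) l0 u v" for u v
  have l: "l e \<ge> 0" "l0 e \<ge> 0" for e
    unfolding l0_def l_def zero_on_def by auto
  have finI: "finite I" using I finite_subset by blast
  have P_iff: "P u v \<longleftrightarrow> ?arcs u v" if uv: "u < v" "v < n" for u v
  proof -
    have l0: "l0 (cycle_edge n i) = (if i \<in> I then 0 else 1)" if "i \<in> {1..n}" for i
      unfolding l0_def zero_on_def l_def
      using inj_on_image_mem_iff[OF inj_on_cycle_edge[OF n] that I] by simp
    have sum0: "(\<Sum>i\<in>A. l0 (cycle_edge n i)) = real (card A) - real (card (I \<inter> A))"
      if A: "A \<subseteq> {1..n}" for A
    proof -
      have finA: "finite A" using A finite_subset by blast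
      have "(\<Sum>i\<in>A. l0 (cycle_edge n i)) = (\<Sum>i\<in>A. 1 - (if i \<in> I then 1 else 0))"
        by (rule sum.cong) (use A l0 in auto)
      also have "\<dots> = real (card A) - real (card (A \<inter> I))"
        using finA by (simp add: sum_subtractf sum.inter_restrict[symmetric])
      finally show ?thesis by (simp add: Int_commute)
    qed
    have J: "I \<inter> ({1..n} - {u<..v}) = I - {u<..v}" using I by auto
    have sub: "{u<..v} \<subseteq> {1..n}" using uv by auto
    have c: "card {u<..v} = v - u" "card ({1..n} - {u<..v}) = n - (v - u)"
      using card_Diff_subset[OF _ sub] by simp_all
    have "sp_dist (cycle n) l0 u v = min (real (v - u) - real (card (I \<inter> {u<..v})))
       (real (n - (v - u)) - real (card (I - {u<..v})))"
      using sp_dist_cycle[of n u v l0, OF n uv l(2)] sum0[OF sub] sum0[of "{1..n} - {u<..v}"] c J by simp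
    moreover have "sp_dist (cycle n) l u v = real (min (v - u) (n - (v - u)))"
      using sp_dist_cycle[of n u v l, OF n uv l(1)] c by (simp add: l_def of_nat_min)
    \<comment> \<open>Exchanging d and n - d leaves \<open>min d (n - d)\<close> unchanged, so both
      arcs are compared with the same original distance.\<close>
    moreover have "n - (n - (v - u)) = v - u" using uv by simp
    ultimately show ?thesis
      by (simp only: P_def le_arc_bound_iff min.bounded_iff min.commute[of "n - (v - u)" "v - u"])
  qed
  \<comment> \<open>Pairs u = v require \<phi>(0) = -\<beta> \<le> 0.\<close>
  have refl: "P u u" if "u < n" for u
  proof -
    have "sp_dist (cycle n) l u u = 0" "sp_dist (cycle n) l0 u u = 0"
      by (rule sp_dist_refl, use l that in auto)+
    then show ?thesis unfolding P_def using \<beta> by simp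
  qed
  have sym: "P u v \<longleftrightarrow> P v u" for u v
    using sp_dist_commute[of "cycle n" l u v] sp_dist_commute[of "cycle n" l0 u v] by (simp add: P_def)
  have ne: "paths (cycle n) u v \<noteq> {}" if "u < v" "v < n" for u v
    by (rule cycle_arcs[OF that n]) auto
  have "is_contraction (cycle n) l (\<lambda>x. x / \<alpha> - \<beta>) (cycle_edge n ` I) \<longleftrightarrow>
     (\<forall>u<n. \<forall>v<n. paths (cycle n) u v \<noteq> {} \<longrightarrow> P u v)"
    using image_mono[OF I, of "cycle_edge n"] by (simp add: is_contraction_def P_def l0_def Ball_def)
  also have "\<dots> \<longleftrightarrow> (\<forall>u v. u < v \<and> v < n \<longrightarrow> P u v)"
  proof (intro iffI allI impI)
    fix u v assume *: "\<forall>u v. u < v \<and> v < n \<longrightarrow> P u v" and "u < n" "v < n"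
    then show "P u v" using refl sym by (metis linorder_neqE_nat)
  next
    fix u v assume "\<forall>u<n. \<forall>v<n. paths (cycle n) u v \<noteq> {} \<longrightarrow> P u v" "u < v \<and> v < n"
    then show "P u v" using ne by (meson order_less_trans)
  qed
  finally show ?thesis unfolding l_def using P_iff by auto
qed

section \<open>Optimality of the number of contracted edges\<close>

lemma lambda'_eq: "lambda' n \<alpha> \<beta> = (MIN d\<in>{1..n - 1}. of_int (arc_bound n \<alpha> \<beta> d) / real d)"
  by (simp add: lambda'_def arc_bound_def)

lemma lambda_le_one: "lambda n \<alpha> \<beta> \<le> 1"
  by (simp add: lambda_def)

lemma lambda_nonneg:
  assumes "n \<ge> 2" "\<alpha> \<ge> 1" "\<beta> \<ge> 0"
  shows "lambda n \<alpha> \<beta> \<ge> 0"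
proof -
  have "lambda' n \<alpha> \<beta> \<ge> 0"
    unfolding lambda'_eq using assms(1) by (subst Min_ge_iff) (auto simp: arc_bound_nonneg[OF assms(2,3)])
  then show ?thesis by (simp add: lambda_def)
qed

lemma lambda_mult_le:
  assumes "d \<in> {1..n - 1}"
  shows "lambda n \<alpha> \<beta> * real d \<le> of_int (arc_bound n \<alpha> \<beta> d)"
proof -
  have "lambda' n \<alpha> \<beta> \<le> of_int (arc_bound n \<alpha> \<beta> d) / real d"
    unfolding lambda'_eq by (rule Min_le) (use assms in auto)
  then have "lambda n \<alpha> \<beta> \<le> of_int (arc_bound n \<alpha> \<beta> d) / real d"
    by (simp add: lambda_def min_le_iff_disj)
  then show ?thesis using assms by (simp add: pos_le_divide_eq)
qed

text \<open>For 0 \<le> x \<le> 1 these are the positions of the letter 1 in the mechanical word of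
  slope x, an evenly spread set of density x.\<close>

definition beatty_jumps :: "real \<Rightarrow> nat \<Rightarrow> nat set" where
  "beatty_jumps x n = {i \<in> {1..n}. \<lfloor>x * real i\<rfloor> - \<lfloor>x * (real i - 1)\<rfloor> = 1}"

lemma greedy_eq: "greedy n \<alpha> \<beta> = cycle_edge n ` beatty_jumps (lambda n \<alpha> \<beta>) n"
  by (auto simp: greedy_def beatty_jumps_def)

lemma beatty_jumps_subset: "beatty_jumps x n \<subseteq> {1..n}"
  by (auto simp: beatty_jumps_def)

text \<open>Since 0 \<le> x \<le> 1, every increment of the floor is 0 or 1. Counting jumps is
  therefore summing increments, and the sum telescopes.\<close>

lemma card_beatty_jumps_interval:
  assumes x: "0 \<le> x" "x \<le> 1" and uv: "u \<le> v" "v \<le> n"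
  shows "int (card (beatty_jumps x n \<inter> {u<..v})) = \<lfloor>x * real v\<rfloor> - \<lfloor>x * real u\<rfloor>"
proof -
  let ?f = "\<lambda>i. \<lfloor>x * real i\<rfloor>"
  have step: "?f (Suc i) - ?f i \<in> {0, 1}" for i
  proof -
    have "?f i \<le> ?f (Suc i)" using x by (intro floor_mono mult_left_mono) auto
    moreover have "?f (Suc i) \<le> \<lfloor>x * real i + 1\<rfloor>"
      using x by (intro floor_mono) (simp add: algebra_simps)
    ultimately show ?thesis by auto
  qed
  show ?thesis using uv
  proof (induction v rule: dec_induct)
    case base
    show ?case by simp
  next
    case (step v)
    have "{u<..Suc v} = insert (Suc v) {u<..v}" using step by auto
    moreover have "Suc v \<in> beatty_jumps x n \<longleftrightarrow> ?f (Suc v) - ?f v = 1"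
      using step by (simp add: beatty_jumps_def)
    ultimately show ?case using step \<open>?f (Suc v) - ?f v \<in> {0, 1}\<close>
      by (cases "Suc v \<in> beatty_jumps x n") auto
  qed
qed

lemma card_beatty_jumps:
  assumes "0 \<le> x" "x \<le> 1"
  shows "int (card (beatty_jumps x n)) = \<lfloor>x * real n\<rfloor>"
proof -
  have "beatty_jumps x n = beatty_jumps x n \<inter> {0<..n}" by (auto simp: beatty_jumps_def)
  then show ?thesis using card_beatty_jumps_interval[OF assms, of 0 n n] by simp
qed

text \<open>A difference of floors can exceed the floor of the difference by 1; an integer bound
  \<open>k\<close> absorbs this rounding.\<close>

lemma floor_diff_le:
  fixes x y :: real
  assumes "x - y \<le> of_int k"
  shows "\<lfloor>x\<rfloor> - \<lfloor>y\<rfloor> \<le> k"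
proof -
  have "\<lfloor>x\<rfloor> \<le> \<lfloor>y + of_int k\<rfloor>" using assms by (intro floor_mono) simp
  then show ?thesis by simp
qed

lemma is_contraction_greedy:
  assumes n: "n \<ge> 3" and "\<alpha> \<ge> 1" "\<beta> \<ge> 0"
  shows "is_contraction (cycle n) (\<lambda>_. 1) (\<lambda>x. x / \<alpha> - \<beta>) (greedy n \<alpha> \<beta>)"
proof -
  define x where "x = lambda n \<alpha> \<beta>"
  define I where "I = beatty_jumps x n"
  have x: "0 \<le> x" "x \<le> 1"
    unfolding x_def using assms lambda_nonneg lambda_le_one by auto
  have "int (card (I \<inter> {u<..v})) \<le> arc_bound n \<alpha> \<beta> (v - u)"
    "int (card (I - {u<..v})) \<le> arc_bound n \<alpha> \<beta> (n - (v - u))" if uv: "u < v" "v < n" for u v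
  proof -
    have d: "v - u \<in> {1..n - 1}" "n - (v - u) \<in> {1..n - 1}"
      using uv by auto
    have k: "int (card (I \<inter> {u<..v})) = \<lfloor>x * real v\<rfloor> - \<lfloor>x * real u\<rfloor>"
      unfolding I_def using card_beatty_jumps_interval[OF x] uv by simp
    show "int (card (I \<inter> {u<..v})) \<le> arc_bound n \<alpha> \<beta> (v - u)"
      unfolding k using lambda_mult_le[OF d(1), of \<alpha> \<beta>] uv
      by (intro floor_diff_le) (auto simp: x_def algebra_simps of_nat_diff)
    have "finite I" unfolding I_def using beatty_jumps_subset finite_subset by blast
    then have "int (card (I - {u<..v})) = int (card I) - int (card (I \<inter> {u<..v}))"
      by (simp add: card_Diff_subset_Int of_nat_diff card_mono)
    also have "\<dots> = \<lfloor>x * real n\<rfloor> + \<lfloor>x * real u\<rfloor> - \<lfloor>x * real v\<rfloor>"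
      unfolding k unfolding I_def card_beatty_jumps[OF x] by simp
    \<comment> \<open>The complementary arc consists of the indices after v and those up to u, so
      three floors occur. Superadditivity merges two of them, and the remaining arguments differ by
      x times n - (v - u).\<close>
    also have "\<dots> \<le> \<lfloor>x * real n + x * real u\<rfloor> - \<lfloor>x * real v\<rfloor>"
      using le_floor_add by simp
    also have "\<dots> \<le> arc_bound n \<alpha> \<beta> (n - (v - u))"
      using lambda_mult_le[OF d(2), of \<alpha> \<beta>] uv
      by (intro floor_diff_le) (auto simp: x_def algebra_simps of_nat_diff)
    finally show "int (card (I - {u<..v})) \<le> arc_bound n \<alpha> \<beta> (n - (v - u))" .
  qed
  then show ?thesis
    unfolding greedy_eq x_def[symmetric] I_def[symmetric]
    using is_contraction_cycle_iff[OF n] beatty_jumps_subset assms I_def by simp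
qed

text \<open>Double counting of pairs of an index in \<open>I\<close> and a start vertex whose arc of
  d edges contains it: every index lies in d of the n arcs, and every arc holds at most b indices of
  \<open>I\<close>.\<close>

lemma card_le_of_arcs:
  assumes I: "I \<subseteq> {1..n}" and d: "d \<in> {1..n - 1}"
    and inner: "\<And>u. u + d < n \<Longrightarrow> card (I \<inter> {u<..u + d}) \<le> b"
    and outer: "\<And>u. u < d \<Longrightarrow> card (I - {u<..u + (n - d)}) \<le> b"
  shows "d * card I \<le> n * b"
proof -
  \<comment> \<open>The arc of d edges starting at vertex s. From s + d = n on it is described as
    the complement of the n - d edges between its end s + d - n and its start s.\<close>
  define arc where "arc s = (if s + d < n then I \<inter> {s<..s + d} else I - {s + d - n<..s})" for s
  have finI: "finite I" using I finite_subset by blast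
  have arc_sub: "arc s \<subseteq> I" for s by (auto simp: arc_def)
  have arc_le: "card (arc s) \<le> b" if "s < n" for s
    using that d inner[of s] outer[of "s + d - n"] by (auto simp: arc_def)
  have starts: "card {s \<in> {..<n}. i \<in> arc s} = d" if i: "i \<in> I" for i
  proof -
    have "i \<in> {1..n}" using i I by auto
    \<comment> \<open>Truncated subtraction clips the first interval at 0 when i < d. Exactly then
      the second one is nonempty, supplying the d - i starts whose arcs wrap around to i.\<close>
    then have S: "{s \<in> {..<n}. i \<in> arc s} = {i - d..<i} \<union> {i + n - d..<n}"
      using i d by (auto simp: arc_def split: if_splits)
    have c: "card ({i - d..<i} \<union> {i + n - d..<n}) = (i - (i - d)) + (n - (i + n - d))"
      using \<open>i \<in> {1..n}\<close> d by (subst card_Un_disjoint) auto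
    show ?thesis
      unfolding S c using \<open>i \<in> {1..n}\<close> d by (simp only: atLeastAtMost_iff) arith
  qed
  have "d * card I = (\<Sum>i\<in>I. card {s \<in> {..<n}. i \<in> arc s})"
    using starts by simp
  also have "\<dots> = (\<Sum>s<n. card {i \<in> I. i \<in> arc s})"
    using finI sum.swap_restrict[of I "{..<n}" "\<lambda>_ _. 1::nat" "\<lambda>i s. i \<in> arc s"] by simp
  also have "\<dots> = (\<Sum>s<n. card (arc s))"
    using arc_sub by (intro sum.cong refl arg_cong[of _ _ card]) auto
  also have "\<dots> \<le> (\<Sum>s<n. b)" using arc_le by (intro sum_mono) auto
  finally show ?thesis by simp
qed

text \<open>Averaging bounds the density |I| / n by \<open>arc_bound\<close> of d over d for each d,
  hence by \<open>lambda'\<close>. The trivial |I| \<le> n accounts for the 1 in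
  \<open>lambda\<close>, and integrality of |I| for the floor.\<close>

lemma card_contraction_le:
  assumes n: "n \<ge> 3" and ab: "\<alpha> \<ge> 1" "\<beta> \<ge> 0" and I: "I \<subseteq> {1..n}"
    and C: "is_contraction (cycle n) (\<lambda>_. 1) (\<lambda>x. x / \<alpha> - \<beta>) (cycle_edge n ` I)"
  shows "int (card I) \<le> \<lfloor>lambda n \<alpha> \<beta> * real n\<rfloor>"
proof -
  have "card I \<le> n" using card_mono[OF _ I] by simp
  have "real (card I) / real n \<le> of_int (arc_bound n \<alpha> \<beta> d) / real d" if d: "d \<in> {1..n - 1}" for d
  proof -
    define b where "b = nat (arc_bound n \<alpha> \<beta> d)"
    have arcs: "int (card (I \<inter> {u<..v})) \<le> arc_bound n \<alpha> \<beta> (v - u)"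
      "int (card (I - {u<..v})) \<le> arc_bound n \<alpha> \<beta> (n - (v - u))" if "u < v" "v < n" for u v
      using C that unfolding is_contraction_cycle_iff[OF n I ab(2)] by auto
    have "d * card I \<le> n * b"
      using I d
    proof (rule card_le_of_arcs)
      show "card (I \<inter> {u<..u + d}) \<le> b" if "u + d < n" for u
        using arcs(1)[of u "u + d"] that d by (simp add: b_def)
      show "card (I - {u<..u + (n - d)}) \<le> b" if "u < d" for u
      proof -
        have "u < u + (n - d)" "u + (n - d) < n" "n - (u + (n - d) - u) = d"
          using that d by auto
        then show ?thesis using arcs(2)[of u "u + (n - d)"] by (simp add: b_def)
      qed
    qed
    then have "real d * real (card I) \<le> real n * real b"
      by (metis of_nat_mono of_nat_mult)
    moreover have "real b = of_int (arc_bound n \<alpha> \<beta> d)"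
      unfolding b_def using arc_bound_nonneg[OF ab] by simp
    ultimately show ?thesis using n d by (simp add: field_simps)
  qed
  then have "real (card I) / real n \<le> lambda' n \<alpha> \<beta>"
    unfolding lambda'_eq using n by (subst Min_ge_iff) auto
  then have "real (card I) / real n \<le> lambda n \<alpha> \<beta>"
    unfolding lambda_def using \<open>card I \<le> n\<close> n by simp
  then have "real (card I) \<le> lambda n \<alpha> \<beta> * real n"
    using n by (simp add: divide_le_eq)
  then show ?thesis by (simp add: le_floor_iff)
qed

section \<open>Contracting edges of a cycle\<close>

text \<open>Its reflexive transitive closure replaces the simple paths behind
  \<open>comp_of\<close>: a concatenation of simple paths need not be simple, whereas the closure is
  transitive.\<close>

definition adjacent :: "'v sgraph \<Rightarrow> ('v \<times> 'v) set" where
  "adjacent G = {(x, y). x \<in> verts G \<and> y \<in> verts G \<and> {x, y} \<in> edges G}"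

text \<open>Each further vertex either extends the simple path found so far or already lies on it,
  in which case the path is cut off there.\<close>

lemma path_to_if_adjacent:
  assumes "(u, v) \<in> (adjacent G)\<^sup>*" and u: "u \<in> verts G"
  shows "paths G u v \<noteq> {}"
  using assms(1)
proof (induction rule: rtrancl_induct)
  case base
  have "[u] \<in> paths G u u" using u by (simp add: mem_paths_iff)
  then show ?case by blast
next
  case (step v w)
  then obtain p where p: "p \<in> paths G u v" by blast
  have w: "w \<in> verts G" "{v, w} \<in> edges G" using step(2) by (auto simp: adjacent_def)
  show ?case
  proof (cases "w \<in> set p")
    case True
    then obtain xs ys where split: "p = xs @ w # ys" by (meson split_list)
    have "set (path_edges (xs @ [w])) \<subseteq> set (path_edges p)"
      unfolding split using path_edges_append[of "xs @ [w]" ys] by (cases ys) auto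
    moreover have "hd (xs @ [w]) = hd p" unfolding split by (cases xs) auto
    ultimately have "xs @ [w] \<in> paths G u w"
      using p unfolding mem_paths_iff split by auto
    then show ?thesis by blast
  next
    case False
    then have "p @ [w] \<in> paths G u w"
      using p w unfolding mem_paths_iff by (auto simp: path_edges_append)
    then show ?thesis by blast
  qed
qed

lemma comp_of_eqI:
  assumes e: "{u, v} \<in> C" and v: "u \<in> verts G" "v \<in> verts G"
  shows "comp_of G C u = comp_of G C v"
proof -
  let ?H = "G\<lparr>edges := C\<rparr>"
  have reach: "(x, y) \<in> (adjacent ?H)\<^sup>*" if "p \<in> paths ?H x y" for p x y
  proof -
    have "(hd p, last p) \<in> (adjacent ?H)\<^sup>*"
      if "p \<noteq> []" "set p \<subseteq> verts G" "set (path_edges p) \<subseteq> C"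
      using that
    proof (induction p rule: induct_list012)
      case (3 x y p)
      then have "(x, y) \<in> adjacent ?H" "(y, last (y # p)) \<in> (adjacent ?H)\<^sup>*"
        by (auto simp: adjacent_def)
      then show ?case by (simp add: converse_rtrancl_into_rtrancl)
    qed simp_all
    then show ?thesis using that by (simp add: mem_paths_iff)
  qed
  have "comp_of G C x = {y. (x, y) \<in> (adjacent ?H)\<^sup>*}" if "x \<in> verts G" for x
    unfolding comp_of_def using reach path_to_if_adjacent[of x _ ?H] that by auto
  moreover have "(u, v) \<in> adjacent ?H" "(v, u) \<in> adjacent ?H"
    using e v by (auto simp: adjacent_def insert_commute)
  ultimately show ?thesis
    using v by (auto intro: converse_rtrancl_into_rtrancl)
qed

text \<open>Used contrapositively: a vertex set whose border no edge of \<open>C\<close> crosses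
  separates components.\<close>

lemma comp_of_eqD:
  assumes eq: "comp_of G C u = comp_of G C v" and v: "v \<in> verts G"
    and closed: "\<And>x y. {x, y} \<in> C \<Longrightarrow> x \<in> S \<longleftrightarrow> y \<in> S"
  shows "u \<in> S \<longleftrightarrow> v \<in> S"
proof -
  have "[v] \<in> paths (G\<lparr>edges := C\<rparr>) v v" using v by (simp add: mem_paths_iff)
  then have "v \<in> comp_of G C u" unfolding eq by (auto simp: comp_of_def)
  then obtain p where "p \<in> paths (G\<lparr>edges := C\<rparr>) u v" by (auto simp: comp_of_def)
  then have p: "p \<noteq> []" "set (path_edges p) \<subseteq> C" "hd p = u" "last p = v"
    by (auto simp: mem_paths_iff)
  have "hd p \<in> S \<longleftrightarrow> last p \<in> S"
    by (rule hd_in_iff_last_in[OF p(1)]) (rule closed, use p(2) in auto)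
  then show ?thesis using p by simp
qed

text \<open>Vertex \<open>0\<close> also appears as \<open>n\<close>, so that \<open>cycle_edge n i\<close> always joins \<open>i - 1\<close> and \<open>i\<close>.\<close>

definition cycle_comp :: "nat \<Rightarrow> nat set \<Rightarrow> nat \<Rightarrow> nat set" where
  "cycle_comp n I i = comp_of (cycle n) (cycle_edge n ` I) (i mod n)"

context
  fixes n :: nat and I :: "nat set"
  assumes n: "n \<ge> 3" and I: "I \<subseteq> {1..n}"
begin

lemma comp_of_cycle_edge:
  assumes "i \<in> {1..n}"
  shows "comp_of (cycle n) (cycle_edge n ` I) ` cycle_edge n i =
    {cycle_comp n I (i - 1), cycle_comp n I i}"
  using assms by (auto simp: cycle_edge_def cycle_comp_def)

lemma cycle_comp_0: "cycle_comp n I n = cycle_comp n I 0"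
  by (simp add: cycle_comp_def)

lemma cycle_comp_eqI:
  assumes "a \<le> b" "b \<le> n" "{a<..b} \<subseteq> I"
  shows "cycle_comp n I a = cycle_comp n I b"
  using assms
proof (induction b rule: dec_induct)
  case (step b)
  have "Suc b \<in> I" using step by auto
  then have "cycle_edge n (Suc b) \<in> cycle_edge n ` I" by blast
  then have "cycle_comp n I b = cycle_comp n I (Suc b)"
    unfolding cycle_comp_def using n step
    by (intro comp_of_eqI) (auto simp: cycle_edge_def)
  then show ?case using step by (auto simp: subset_iff)
qed simp

text \<open>The uncontracted edges a and b are the only ones crossing the border of the block
  \<open>{a..<b}\<close>, so no component meets both the block and its complement.\<close>

lemma cycle_comp_neqI:
  assumes ab: "a \<in> {1..n} - I" "b \<in> {1..n} - I" "a < b"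
    and i: "i \<in> {a..<b}" and j: "j \<le> n" "j \<notin> {a..<b}"
  shows "cycle_comp n I i \<noteq> cycle_comp n I j"
proof
  assume eq: "cycle_comp n I i = cycle_comp n I j"
  have closed: "x \<in> {a..<b} \<longleftrightarrow> y \<in> {a..<b}" if "{x, y} \<in> cycle_edge n ` I" for x y
  proof -
    from that obtain k where k: "{x, y} = cycle_edge n k" "k \<in> I" by (rule imageE)
    then have "k \<in> {1..n}" "k \<noteq> a" "k \<noteq> b" using ab I by auto
    then show ?thesis using ab k by (intro cycle_edge_not_crossing[of a b n k]) auto
  qed
  have "i mod n \<in> {a..<b} \<longleftrightarrow> j mod n \<in> {a..<b}"
    using eq[unfolded cycle_comp_def] _ closed by (rule comp_of_eqD) (use n in simp)
  \<comment> \<open>The position j = n stands for vertex 0, which is outside the block since a \<ge>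
    1.\<close>
  moreover have "i mod n = i" "j mod n = (if j = n then 0 else j)"
    using i j ab by auto
  ultimately show False using i j ab by (auto split: if_splits)
qed

lemma edges_contract_cycle:
  "edges (contract (cycle n) (cycle_edge n ` I)) =
    (\<lambda>i. {cycle_comp n I (i - 1), cycle_comp n I i}) `
      {i \<in> {1..n} - I. cycle_comp n I (i - 1) \<noteq> cycle_comp n I i}"
proof -
  have "edges (cycle n) - cycle_edge n ` I = cycle_edge n ` ({1..n} - I)"
    using inj_on_image_set_diff[OF inj_on_cycle_edge[OF n], of "{1..n}" I] I by simp
  then have "edges (contract (cycle n) (cycle_edge n ` I)) =
    (\<lambda>i. comp_of (cycle n) (cycle_edge n ` I) ` cycle_edge n i) `
      {i \<in> {1..n} - I. card (comp_of (cycle n) (cycle_edge n ` I) ` cycle_edge n i) \<noteq> 1}"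
    unfolding contract_def by auto
  also have "\<dots> = (\<lambda>i. {cycle_comp n I (i - 1), cycle_comp n I i}) `
      {i \<in> {1..n} - I. card {cycle_comp n I (i - 1), cycle_comp n I i} \<noteq> 1}"
    by (intro image_cong Collect_cong) (auto simp: comp_of_cycle_edge simp del: One_nat_def)
  finally have "edges (contract (cycle n) (cycle_edge n ` I)) = \<dots>" .
  moreover have "card {x, y} \<noteq> 1 \<longleftrightarrow> x \<noteq> y" for x y :: "nat set"
    by (cases "x = y") auto
  ultimately show ?thesis by (simp only:)
qed

text \<open>If only edges a < b survive, the contracted edges form two segments, one from a to b - 1
  and one from b through n = 0 to a - 1. Both survivors join these two segments and become
  parallel.\<close>

lemma card_edges_contract_le_one:
  assumes "card ({1..n} - I) \<le> 2"
  shows "card (edges (contract (cycle n) (cycle_edge n ` I))) \<le> 1" (is "card ?E \<le> 1")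
proof -
  let ?f = "\<lambda>i. {cycle_comp n I (i - 1), cycle_comp n I i}"
  have "?f a = ?f b" if ab: "a \<in> {1..n} - I" "b \<in> {1..n} - I" "a < b" for a b
  proof -
    have "{a, b} \<subseteq> {1..n} - I" using ab by auto
    then have ab_eq: "{1..n} - I = {a, b}"
      using assms ab(3) card_seteq[of "{1..n} - I" "{a, b}"] by auto
    have mem: "i \<in> I" if "i \<in> {1..n}" "i \<noteq> a" "i \<noteq> b" for i
      using that ab_eq by blast
    have "cycle_comp n I a = cycle_comp n I (b - 1)"
      by (rule cycle_comp_eqI) (use ab in \<open>auto intro!: mem\<close>)
    moreover have "cycle_comp n I b = cycle_comp n I n"
      by (rule cycle_comp_eqI) (use ab in \<open>auto intro!: mem\<close>)
    moreover have "cycle_comp n I 0 = cycle_comp n I (a - 1)"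
      by (rule cycle_comp_eqI) (use ab in \<open>auto intro!: mem\<close>)
    ultimately show ?thesis using cycle_comp_0 by auto
  qed
  then have "?f a = ?f b" if "a \<in> {1..n} - I" "b \<in> {1..n} - I" for a b
    using that by (cases a b rule: linorder_cases) (blast, simp, metis)
  then have "x = y" if "x \<in> ?E" "y \<in> ?E" for x y
    using that unfolding edges_contract_cycle by blast
  moreover have "finite ?E" unfolding edges_contract_cycle by simp
  ultimately show ?thesis by (simp add: card_le_Suc0_iff_eq)
qed

text \<open>The ends of a single surviving edge are connected through the rest of the cycle, so it
  becomes a loop.\<close>

lemma edges_contract_eq_empty:
  assumes "card ({1..n} - I) \<le> 1"
  shows "edges (contract (cycle n) (cycle_edge n ` I)) = {}"
proof -
  have "cycle_comp n I (a - 1) = cycle_comp n I a" if a: "a \<in> {1..n} - I" for a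
  proof -
    have a_eq: "{1..n} - I = {a}"
      using assms a card_seteq[of "{1..n} - I" "{a}"] by auto
    have mem: "i \<in> I" if "i \<in> {1..n}" "i \<noteq> a" for i
      using that a_eq by blast
    have "cycle_comp n I a = cycle_comp n I n"
      by (rule cycle_comp_eqI) (use a in \<open>auto intro!: mem\<close>)
    moreover have "cycle_comp n I 0 = cycle_comp n I (a - 1)"
      by (rule cycle_comp_eqI) (use a in \<open>auto intro!: mem\<close>)
    ultimately show ?thesis using cycle_comp_0 by simp
  qed
  then show ?thesis unfolding edges_contract_cycle by auto
qed

text \<open>A second surviving edge b keeps edge a from becoming a loop: the block between them
  contains exactly one of a - 1 and a.\<close>

lemma cycle_comp_step_neq:
  assumes "a \<in> {1..n} - I" "b \<in> {1..n} - I" "a \<noteq> b"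
  shows "cycle_comp n I (a - 1) \<noteq> cycle_comp n I a"
proof (cases "a < b")
  case True
  have "cycle_comp n I a \<noteq> cycle_comp n I (a - 1)"
    by (rule cycle_comp_neqI[of a b]) (use True assms in auto)
  then show ?thesis by (rule not_sym)
next
  case False
  show ?thesis
    by (rule cycle_comp_neqI[of b a]) (use False assms in auto)
qed

lemma edges_contract_neq_empty:
  assumes "card ({1..n} - I) \<ge> 2"
  shows "edges (contract (cycle n) (cycle_edge n ` I)) \<noteq> {}"
proof -
  obtain a b where "a \<in> {1..n} - I" "b \<in> {1..n} - I" "a \<noteq> b"
    using assms by (meson card_2_iff' obtain_subset_with_card_n subset_iff)
  then show ?thesis unfolding edges_contract_cycle using cycle_comp_step_neq by blast
qed

text \<open>A third surviving edge c keeps edges a and b from becoming parallel: the block between c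
  and one of them contains an end of that edge and no end of the other.\<close>

lemma card_edges_contract_eq:
  assumes "card ({1..n} - I) \<ge> 3"
  shows "card (edges (contract (cycle n) (cycle_edge n ` I))) = card ({1..n} - I)"
proof -
  let ?c = "cycle_comp n I"
  have neq: "{?c (a - 1), ?c a} \<noteq> {?c (b - 1), ?c b}"
    if ab: "a \<in> {1..n} - I" "b \<in> {1..n} - I" "a < b" for a b
  proof -
    have "\<not> {1..n} - I \<subseteq> {a, b}"
      using assms ab(3) card_mono[of "{a, b}" "{1..n} - I"] by auto
    then obtain c where c: "c \<in> {1..n} - I" "c \<noteq> a" "c \<noteq> b" by blast
    then consider "c < a" | "a < c" "c < b" | "b < c" by linarith
    then show ?thesis
    proof cases
      case 1
      have "?c (a - 1) \<noteq> ?c j" if "j \<in> {b - 1, b}" for j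
        by (rule cycle_comp_neqI[of c a]) (use that 1 c ab in auto)
      then show ?thesis by (auto simp: doubleton_eq_iff)
    next
      case 2
      have "?c a \<noteq> ?c j" if "j \<in> {b - 1, b}" for j
        by (rule cycle_comp_neqI[of a c]) (use that 2 c ab in auto)
      then show ?thesis by (auto simp: doubleton_eq_iff)
    next
      case 3
      have "?c b \<noteq> ?c j" if "j \<in> {a - 1, a}" for j
        by (rule cycle_comp_neqI[of b c]) (use that 3 c ab in auto)
      then show ?thesis by (auto simp: doubleton_eq_iff)
    qed
  qed
  have inj: "inj_on (\<lambda>i. {?c (i - 1), ?c i}) ({1..n} - I)"
  proof (rule inj_onI)
    fix a b assume "a \<in> {1..n} - I" "b \<in> {1..n} - I" "{?c (a - 1), ?c a} = {?c (b - 1), ?c b}"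
    then show "a = b" using neq by (metis linorder_neqE_nat)
  qed
  have "?c (a - 1) \<noteq> ?c a" if "a \<in> {1..n} - I" for a
  proof -
    have "\<not> {1..n} - I \<subseteq> {a}"
      using assms card_mono[of "{a}" "{1..n} - I"] by auto
    then show ?thesis using that cycle_comp_step_neq by blast
  qed
  then have "{i \<in> {1..n} - I. ?c (i - 1) \<noteq> ?c i} = {1..n} - I" by blast
  then show ?thesis unfolding edges_contract_cycle using card_image[OF inj] by simp
qed

end

section \<open>Monotonicity of \<Phi> in the number of contracted edges\<close>

lemma simple_graph_cycle:
  assumes "n \<ge> 3" shows "simple_graph (cycle n)"
  unfolding simple_graph_def
proof (intro conjI ballI)
  fix e assume "e \<in> edges (cycle n)"
  then obtain i where i: "i \<in> {1..n}" "e = cycle_edge n i" by auto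
  moreover have "i - 1 \<noteq> i mod n" using i assms by (cases "i = n") auto
  moreover have "i - 1 \<in> verts (cycle n)" "i mod n \<in> verts (cycle n)" using i assms by auto
  ultimately show "\<exists>u\<in>verts (cycle n). \<exists>v\<in>verts (cycle n). u \<noteq> v \<and> e = {u, v}"
    unfolding cycle_edge_def by blast
qed simp

text \<open>With r uncontracted edges the contracted cycle has 0 edges for r \<le> 1, one for r = 2
  and r for r \<ge> 3, which is non-decreasing in r.\<close>

lemma card_edges_contract_antimono:
  assumes n: "n \<ge> 3" and I: "I \<subseteq> {1..n}" and J: "J \<subseteq> {1..n}" and le: "card J \<le> card I"
  shows "card (edges (contract (cycle n) (cycle_edge n ` I)))
    \<le> card (edges (contract (cycle n) (cycle_edge n ` J)))" (is "card (?E I) \<le> card (?E J)")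
proof -
  have c: "card ({1..n} - I) = n - card I" "card ({1..n} - J) = n - card J"
    using I J by (simp_all add: card_Diff_subset finite_subset)
  consider "card ({1..n} - I) \<le> 1" | "card ({1..n} - I) = 2" | "card ({1..n} - I) \<ge> 3" by linarith
  then show ?thesis
  proof cases
    case 1
    then show ?thesis using edges_contract_eq_empty[OF n I] by simp
  next
    case 2
    then have "?E J \<noteq> {}" using le c by (intro edges_contract_neq_empty[OF n J]) linarith
    moreover have "finite (?E J)" unfolding edges_contract_cycle[OF n J] by simp
    ultimately have "card (?E J) \<ge> 1" by (simp add: Suc_le_eq card_gt_0_iff)
    then show ?thesis using card_edges_contract_le_one[OF n I] 2 by simp
  next
    case 3
    moreover have "card ({1..n} - J) \<ge> card ({1..n} - I)" using le c by simp
    ultimately show ?thesis using card_edges_contract_eq[OF n I] card_edges_contract_eq[OF n J] by simp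
  qed
qed

lemma Phi_cycle_mono:
  assumes n: "n \<ge> 3" and I: "I \<subseteq> {1..n}" and J: "J \<subseteq> {1..n}" and le: "card J \<le> card I"
  shows "Phi (cycle n) (cycle_edge n ` J) \<le> Phi (cycle n) (cycle_edge n ` I)"
proof -
  have sub: "cycle_edge n ` K \<subseteq> edges (cycle n)" if "K \<subseteq> {1..n}" for K
    using that by (simp add: image_mono)
  show ?thesis
    using card_edges_contract_antimono[OF assms]
    unfolding Phi_eq(1)[OF simple_graph_cycle[OF n] sub[OF I]]
      Phi_eq(1)[OF simple_graph_cycle[OF n] sub[OF J]] by (rule diff_le_mono2)
qed

section \<open>Running the program\<close>

fun loop_free :: "com \<Rightarrow> bool" where
  "loop_free (Seq c1 c2) \<longleftrightarrow> loop_free c1 \<and> loop_free c2"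
| "loop_free (If b c1 c2) \<longleftrightarrow> loop_free c1 \<and> loop_free c2"
| "loop_free (While b c) \<longleftrightarrow> False"
| "loop_free c \<longleftrightarrow> True"

text \<open>An evaluator that rewriting can unfold on the loop bodies. Its value on
  \<open>While\<close> is a dummy, excluded by \<open>loop_free\<close> in
  \<open>exec_run\<close>.\<close>

fun run :: "com \<Rightarrow> state \<Rightarrow> state" where
  "run (Assign x a) (s, out) = (s(x := aval a s), out)"
| "run (Output a) (s, out) = (s, out @ [aval a s])"
| "run (Seq c1 c2) st = run c2 (run c1 st)"
| "run (If b c1 c2) st = (if bval b (fst st) then run c1 st else run c2 st)"
| "run c st = st"

fun max_cost :: "com \<Rightarrow> nat" where
  "max_cost (Assign x a) = acost a + 1"
| "max_cost (Output a) = acost a + 1"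
| "max_cost (Seq c1 c2) = max_cost c1 + max_cost c2"
| "max_cost (If b c1 c2) = bcost b + max (max_cost c1) (max_cost c2) + 1"
| "max_cost c = 1"

lemma exec_run: "loop_free c \<Longrightarrow> \<exists>t\<le>max_cost c. exec c st t (run c st)"
proof (induction c arbitrary: st)
  case Skip
  then show ?case using exec.Skip[of st] by auto
next
  case (Assign x a)
  then show ?case using exec.Assign by (cases st) auto
next
  case (Output a)
  then show ?case using exec.Output by (cases st) auto
next
  case (Seq c1 c2)
  then obtain t1 t2 where "t1 \<le> max_cost c1" "exec c1 st t1 (run c1 st)"
    "t2 \<le> max_cost c2" "exec c2 (run c1 st) t2 (run c2 (run c1 st))"
    by (meson loop_free.simps(1))
  then show ?case by (intro exI[of _ "t1 + t2"]) (auto intro: exec.Seq)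
next
  case (If b c1 c2)
  show ?case
  proof (cases "bval b (fst st)")
    case True
    obtain t where "t \<le> max_cost c1" "exec c1 st t (run c1 st)"
      using If.IH(1)[of st] If.prems by auto
    then show ?thesis
      using True by (intro exI[of _ "bcost b + t + 1"]) (auto intro: exec.IfTrue[simplified])
  next
    case False
    obtain t where "t \<le> max_cost c2" "exec c2 st t (run c2 st)"
      using If.IH(2)[of st] If.prems by auto
    then show ?thesis
      using False by (intro exI[of _ "bcost b + t + 1"]) (auto intro: exec.IfFalse[simplified])
  qed
qed simp

lemma exec_Assign_run: "exec (Assign x a) st (acost a + 1) (run (Assign x a) st)"
  by (cases st) (simp add: exec.Assign[simplified])

text \<open>Rule for counting loops: the invariant \<open>P\<close> carries a counter that each pass
  increases until the guard fails at \<open>N\<close>. The induction runs downwards from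
  \<open>N\<close>, since a run from k is one pass followed by a run from \<open>Suc k\<close>; the
  last summand of the bound is the failing test.\<close>

lemma exec_while:
  assumes c: "loop_free c"
    and step: "\<And>k st. k < N \<Longrightarrow> P k st \<Longrightarrow> bval b (fst st) \<and> P (Suc k) (run c st)"
    and stop: "\<And>st. P N st \<Longrightarrow> \<not> bval b (fst st)"
    and "k \<le> N" "P k st"
  shows "\<exists>t st'. exec (While b c) st t st' \<and> P N st' \<and>
    t \<le> (N - k) * (bcost b + max_cost c + 1) + (bcost b + 1)"
  using assms(4,5)
proof (induction k arbitrary: st rule: inc_induct)
  case base
  then have "exec (While b c) st (bcost b + 1) st"
    using stop by (intro exec.WhileFalse)
  then show ?case using base by (intro exI[of _ "bcost b + 1"] exI[of _ st]) simp
next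
  case (step k)
  from \<open>k < N\<close> \<open>P k st\<close> have b: "bval b (fst st)" and P: "P (Suc k) (run c st)"
    using assms(2) by auto
  from step.IH[OF P] obtain t2 st' where t2: "exec (While b c) (run c st) t2 st'" "P N st'"
    "t2 \<le> (N - Suc k) * (bcost b + max_cost c + 1) + (bcost b + 1)" by blast
  obtain t1 where t1: "t1 \<le> max_cost c" "exec c st t1 (run c st)"
    using exec_run[OF c] by blast
  have "N - k = Suc (N - Suc k)" using \<open>k < N\<close> by simp
  then have "bcost b + t1 + t2 + 1 \<le> (N - k) * (bcost b + max_cost c + 1) + (bcost b + 1)"
    using t1(1) t2(3) by simp
  then show ?case using exec.WhileTrue[OF b t1(2) t2(1)] t2(2) by blast
qed

text \<open>The content of the variable \<open>lam\<close> when \<open>d\<close> holds k: the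
  candidates below k have been inspected, and 1 is the initial value.\<close>

definition lambda_upto :: "nat \<Rightarrow> real \<Rightarrow> real \<Rightarrow> nat \<Rightarrow> real" where
  "lambda_upto n \<alpha> \<beta> k =
     Min (insert 1 ((\<lambda>d. of_int \<lfloor>real d - real (min d (n - d)) / \<alpha> + \<beta>\<rfloor> / real d) ` {1..<k}))"

lemma lambda_upto_1 [simp]: "lambda_upto n \<alpha> \<beta> (Suc 0) = 1"
  by (simp add: lambda_upto_def)

lemma lambda_upto_Suc:
  assumes "k \<ge> 1"
  shows "lambda_upto n \<alpha> \<beta> (Suc k) =
    min (of_int \<lfloor>real k - real (min k (n - k)) / \<alpha> + \<beta>\<rfloor> / real k) (lambda_upto n \<alpha> \<beta> k)"
proof -
  have "{1..<Suc k} = insert k {1..<k}" using assms by auto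
  then show ?thesis
    unfolding lambda_upto_def by (simp only: image_insert insert_commute[of 1]) (subst Min_insert, auto)
qed

lemma lambda_upto_n: "n \<ge> 2 \<Longrightarrow> lambda_upto n \<alpha> \<beta> n = lambda n \<alpha> \<beta>"
proof -
  assume "n \<ge> 2"
  then have "{1..<n} = {1..n - 1}" "{1..n - 1} \<noteq> {}" by auto
  then show ?thesis
    unfolding lambda_upto_def lambda_def lambda'_def by (subst Min_insert) auto
qed

lemma exec_compute_lambda:
  assumes n: "n \<ge> 3"
  shows "\<exists>t st. exec compute_lambda (greedy_input n \<alpha> \<beta>) t st \<and> t \<le> 50 * n \<and>
    fst st ''n'' = real n \<and> fst st ''lam'' = lambda n \<alpha> \<beta> \<and> snd st = []"
proof -
  define init where "init = Seq (Assign ''lam'' (Const 1)) (Assign ''d'' (Const 1))"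
  define st0 where "st0 = run init (greedy_input n \<alpha> \<beta>)"
  define P where "P k st \<longleftrightarrow> fst st ''n'' = real n \<and> fst st ''alpha'' = \<alpha> \<and> fst st ''beta'' = \<beta> \<and>
    fst st ''d'' = real k \<and> fst st ''lam'' = lambda_upto n \<alpha> \<beta> k \<and> k \<ge> 1 \<and> snd st = []"
    for k and st :: state
  obtain b c where w: "compute_lambda = Seq (Assign ''lam'' (Const 1)) (Seq (Assign ''d'' (Const 1)) (While b c))"
    and b: "b = Less (Var ''d'') (Var ''n'')"
    and c: "c = Seq (If (Less (Var ''d'') (Sub (Var ''n'') (Var ''d'')))
                   (Assign ''m'' (Var ''d''))
                   (Assign ''m'' (Sub (Var ''n'') (Var ''d''))))
           (Seq (Assign ''q''
                   (Div (Floor (Add (Sub (Var ''d'') (Div (Var ''m'') (Var ''alpha''))) (Var ''beta'')))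
                        (Var ''d'')))
           (Seq (If (Less (Var ''q'') (Var ''lam'')) (Assign ''lam'' (Var ''q'')) Skip)
                (Assign ''d'' (Add (Var ''d'') (Const 1)))))"
    unfolding compute_lambda_def by blast
  have "\<exists>t st'. exec (While b c) st0 t st' \<and> P n st' \<and>
    t \<le> (n - 1) * (bcost b + max_cost c + 1) + (bcost b + 1)"
  proof (rule exec_while)
    show "loop_free c" by (simp add: c)
    show "\<not> bval b (fst st)" if "P n st" for st
      using that by (simp add: P_def b)
    show "1 \<le> n" using n by simp
    show "P 1 st0"
      by (simp add: P_def st0_def init_def greedy_input_def)
    fix k st assume k: "k < n" and P: "P k st"
    obtain s out where st: "st = (s, out)" by (cases st)
    \<comment> \<open>The program compares and subtracts in the reals; for k < n this agrees with
      the truncated subtraction in \<open>arc_bound\<close> and \<open>lambda'\<close>.\<close>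
    have m: "real (min k (n - k)) = (if real k < real n - real k then real k else real n - real k)"
      using k by (auto simp: min_def)
    show "bval b (fst st) \<and> P (Suc k) (run c st)"
      using P k lambda_upto_Suc[of k n \<alpha> \<beta>, unfolded m] unfolding P_def st b c
      by (cases "real k < real n - real k") (simp_all add: min_def)
  qed
  then obtain t st' where e: "exec (While b c) st0 t st'" and P: "P n st'"
    and t: "t \<le> (n - 1) * (bcost b + max_cost c + 1) + (bcost b + 1)"
    by blast
  have "exec compute_lambda (greedy_input n \<alpha> \<beta>)
      (acost (Const 1) + 1 + (acost (Const 1) + 1 + t)) st'"
    unfolding w using e unfolding st0_def init_def run.simps(3)
    by (intro exec.Seq[OF exec_Assign_run])
  \<comment> \<open>One pass costs at most 35, so the total is at most 35 (n - 1) + 8; the factor 50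
    is a round upper bound.\<close>
  moreover have "acost (Const 1) + 1 + (acost (Const 1) + 1 + t) \<le> 50 * n"
    using t n by (simp add: b c)
  ultimately show ?thesis
    using P lambda_upto_n[of n \<alpha> \<beta>] n unfolding P_def
    by (intro exI[of _ "acost (Const 1) + 1 + (acost (Const 1) + 1 + t)"] exI[of _ st']) simp
qed

lemma exec_output_edges:
  assumes "n \<ge> 3" and st: "fst st ''n'' = real n" "fst st ''lam'' = x" "snd st = []"
  shows "\<exists>t s. exec output_edges st t (s, map real
      (filter (\<lambda>i. \<lfloor>x * real i\<rfloor> - \<lfloor>x * (real i - 1)\<rfloor> = 1) [1..<Suc n])) \<and> t \<le> 50 * n"
proof -
  define jump where "jump i \<longleftrightarrow> \<lfloor>x * real i\<rfloor> - \<lfloor>x * (real i - 1)\<rfloor> = 1" for i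
  define P where "P k st \<longleftrightarrow> fst st ''n'' = real n \<and> fst st ''lam'' = x \<and>
    fst st ''i'' = real k \<and> k \<ge> 1 \<and> snd st = map real (filter jump [1..<k])"
    for k and st :: state
  obtain b c where w: "output_edges = Seq (Assign ''i'' (Const 1)) (While b c)"
    and b: "b = Leq (Var ''i'') (Var ''n'')"
    and c: "c = Seq (If (Equal (Sub (Floor (Mul (Var ''lam'') (Var ''i'')))
                                (Floor (Mul (Var ''lam'') (Sub (Var ''i'') (Const 1)))))
                           (Const 1))
                   (Output (Var ''i''))
                   Skip)
                (Assign ''i'' (Add (Var ''i'') (Const 1)))"
    unfolding output_edges_def by blast
  \<comment> \<open>The guard is \<le>, so the counter leaves the loop at \<open>Suc n\<close>,
    after n passes.\<close>
  have "\<exists>t st'. exec (While b c) (run (Assign ''i'' (Const 1)) st) t st' \<and> P (Suc n) st' \<and>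
    t \<le> (Suc n - 1) * (bcost b + max_cost c + 1) + (bcost b + 1)"
  proof (rule exec_while)
    show "loop_free c" by (simp add: c)
    show "\<not> bval b (fst st)" if "P (Suc n) st" for st
      using that by (simp add: P_def b)
    show "1 \<le> Suc n" by simp
    show "P 1 (run (Assign ''i'' (Const 1)) st)"
      using st by (cases st) (simp add: P_def)
    fix k st assume k: "k < Suc n" and P: "P k st"
    obtain s out where st: "st = (s, out)" by (cases st)
    \<comment> \<open>\<open>jump\<close> compares integers, the program their images in the
      reals.\<close>
    have "jump k \<longleftrightarrow> real_of_int \<lfloor>x * real k\<rfloor> - real_of_int \<lfloor>x * (real k - 1)\<rfloor> = 1"
      unfolding jump_def by linarith
    then show "bval b (fst st) \<and> P (Suc k) (run c st)"
      using P k unfolding P_def st b c by auto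
  qed
  then obtain t st' where e: "exec (While b c) (run (Assign ''i'' (Const 1)) st) t st'"
    and P: "P (Suc n) st'"
    and t: "t \<le> (Suc n - 1) * (bcost b + max_cost c + 1) + (bcost b + 1)"
    by blast
  have "exec output_edges st (acost (Const 1) + 1 + t) st'"
    unfolding w using e by (intro exec.Seq[OF exec_Assign_run])
  \<comment> \<open>Here one pass costs at most 24, giving at most 24 n + 6.\<close>
  moreover have "acost (Const 1) + 1 + t \<le> 50 * n"
    using t \<open>n \<ge> 3\<close> by (simp add: b c)
  ultimately show ?thesis
    using P unfolding P_def jump_def by (metis prod.collapse)
qed

text \<open>Each of the two phases takes at most 50 n steps, whatever the values of \<alpha> and
  \<beta>.\<close>

lemma greedy_outputs_within_linear:
  assumes n: "n \<ge> 3"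
  shows "greedy_outputs_within n \<alpha> \<beta> (greedy n \<alpha> \<beta>) (100 * n)"
proof -
  let ?x = "lambda n \<alpha> \<beta>"
  let ?js = "filter (\<lambda>i. \<lfloor>?x * real i\<rfloor> - \<lfloor>?x * (real i - 1)\<rfloor> = 1) [1..<Suc n]"
  obtain t1 st where 1: "exec compute_lambda (greedy_input n \<alpha> \<beta>) t1 st" "t1 \<le> 50 * n"
    "fst st ''n'' = real n" "fst st ''lam'' = ?x" "snd st = []"
    using exec_compute_lambda[OF n] by blast
  obtain t2 s where 2: "exec output_edges st t2 (s, map real ?js)" "t2 \<le> 50 * n"
    using exec_output_edges[OF n 1(3-5)] by blast
  have "exec greedy_program (greedy_input n \<alpha> \<beta>) (t1 + t2) (s, map real ?js)"
    unfolding greedy_program_def using 1(1) 2(1) by (rule exec.Seq)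
  moreover have "t1 + t2 \<le> 100 * n" using 1(2) 2(2) by simp
  moreover have "distinct ?js" "set ?js \<subseteq> {1..n}" by auto
  moreover have "greedy n \<alpha> \<beta> = cycle_edge n ` set ?js"
    unfolding greedy_def by (auto simp del: upt_Suc)
  ultimately show ?thesis unfolding greedy_outputs_within_def by blast
qed

section \<open>Optimality and running time\<close>

lemma greedy_optimal:
  assumes n: "n \<ge> 3" and ab: "\<alpha> \<ge> 1" "\<beta> \<ge> 0"
  shows "optimal_solution (cycle n) (\<lambda>_. 1) (\<lambda>x. x / \<alpha> - \<beta>) (greedy n \<alpha> \<beta>)"
  unfolding optimal_solution_def
proof (intro conjI allI impI)
  have "mono_on {0..} (\<lambda>x. x / \<alpha> - \<beta>)"
    using ab(1) by (intro mono_onI) (simp add: divide_right_mono)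
  then show "contraction_instance (cycle n) (\<lambda>_. 1) (\<lambda>x. x / \<alpha> - \<beta>)"
    unfolding contraction_instance_def using simple_graph_cycle[OF n] by simp
  show "is_contraction (cycle n) (\<lambda>_. 1) (\<lambda>x. x / \<alpha> - \<beta>) (greedy n \<alpha> \<beta>)"
    by (rule is_contraction_greedy[OF assms])
  fix C assume C: "is_contraction (cycle n) (\<lambda>_. 1) (\<lambda>x. x / \<alpha> - \<beta>) C"
  then have "C \<subseteq> cycle_edge n ` {1..n}"
    by (simp only: is_contraction_def edges_cycle)
  then obtain J where J: "J \<subseteq> {1..n}" "C = cycle_edge n ` J"
    by (meson subset_imageE)
  have "0 \<le> lambda n \<alpha> \<beta>" using n by (intro lambda_nonneg ab) simp
  \<comment> \<open>The upper bound on any contraction is exactly the number of jumps, so the greedy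
    set has maximum cardinality and \<open>Phi_cycle_mono\<close> applies.\<close>
  then have "int (card J) \<le> int (card (beatty_jumps (lambda n \<alpha> \<beta>) n))"
    using card_contraction_le[OF n ab J(1) C[unfolded J(2)]]
    by (simp add: card_beatty_jumps lambda_le_one)
  then show "Phi (cycle n) C \<le> Phi (cycle n) (greedy n \<alpha> \<beta>)"
    unfolding J(2) greedy_eq by (intro Phi_cycle_mono n J(1) beatty_jumps_subset) simp
qed

theorem theorem3:
  "(\<forall>(n::nat) (\<alpha>::real) (\<beta>::real). n \<ge> 3 \<and> \<alpha> \<ge> 1 \<and> \<beta> \<ge> 0 \<longrightarrow>
      optimal_solution (cycle n) (\<lambda>e. 1) (\<lambda>x. x / \<alpha> - \<beta>) (greedy n \<alpha> \<beta>)) \<and>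
   (\<exists>K::nat. \<forall>(n::nat) (\<alpha>::real) (\<beta>::real). n \<ge> 3 \<and> \<alpha> \<ge> 1 \<and> \<beta> \<ge> 0 \<longrightarrow>
      greedy_outputs_within n \<alpha> \<beta> (greedy n \<alpha> \<beta>) (K * n))"
  using greedy_optimal greedy_outputs_within_linear by blast

end
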